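(* Fix $\xi<\omega_1$. If $f:\widehat{\mathcal{S}}_{\omega^\xi}\to\{0,1\}$ is any function, then either there exists an infinite subset $M$ of $\mathbb{N}$ so that for all $E\in\widehat{\mathcal{S}}_{\omega^\xi}$, $f(M(E))=1$, or there exists a sequence $E_1<E_2<\ldots$ of members of $\widehat{\mathcal{S}}_{\omega^\xi}$ so that $f(E_i)=0$ for all $i\in\mathbb{N}$ and for all $E\in\mathcal{S}_{\omega^\xi}$, $\bigcup_{i\in E}E_i\in\mathcal{S}_{\omega^\xi}$.
   Context: For finite $E,F\subset\mathbb{N}$, $E<F$ means $\max E<\min F$, and $n\leqslant E$ means $n\leqslant\min E$. For an infinite set $M=\{m_1<m_2<\ldots\}\subset\mathbb{N}$ and $E\subset\mathbb{N}$, $M(E)=\{m_n:n\in E\}$. $\widehat{\mathcal{F}}=\mathcal{F}\setminus\{\varnothing\}$. For families $\mathcal{F},\mathcal{G}$ of finite subsets of $\mathbb{N}$, $\mathcal{F}[\mathcal{G}]$ consists of $\varnothing$ and all unions $\bigcup_{i=1}^sE_i$ with $E_1<\ldots<E_s$ non-empty members of $\mathcal{G}$ and $\{\min E_i:1\leqslant i\leqslant s\}\in\mathcal{F}$. Schreier families: $\mathcal{S}_0=\{E:|E|\leqslant1\}$, $\mathcal{S}=\mathcal{S}_1=\{\varnothing\}\cup\{E:|E|\leqslant\min E\}$, $\mathcal{S}_{\xi+1}=\mathcal{S}[\mathcal{S}_\xi]$, and for a limit ordinal $\xi<\omega_1$, $\mathcal{S}_\xi=\{E:\exists n\leqslant E,\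 E\in\mathcal{S}_{\xi_n+1}\}$, where $(\xi_n)$ is a fixed sequence increasing to $\xi$, chosen so that $\mathcal{S}_{\xi_n+1}\subset\mathcal{S}_{\xi_{n+1}}$ for all $n$. (The families depend on the choices of these sequences; any fixed such choice is allowed.) *)

theory Defs
  imports "HOL-Library.Countable_Set" "HOL-Library.Infinite_Set" "HOL-Library.FuncSet"
begin

section \<open>Countable ordinals\<close>

text \<open>The well-order \<^term>\<open>cardSuc natLeq\<close> has order type \<open>\<omega>\<^sub>1\<close>, so the type below is the ordinal
  \<open>\<omega>\<^sub>1\<close> and its elements stand for the ordinals below \<open>\<omega>\<^sub>1\<close>. This is confirmed by
  \<open>uncountable_omega1\<close> and \<open>countable_initial_segment\<close>.\<close>

typedef omega1 = "Field (cardSuc natLeq)"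
  using Field_cardSuc_not_empty natLeq_Card_order by blast

instantiation omega1 :: wellorder
begin

definition less_eq_omega1 :: "omega1 \<Rightarrow> omega1 \<Rightarrow> bool" where
  "a \<le> b \<longleftrightarrow> (Rep_omega1 a, Rep_omega1 b) \<in> cardSuc natLeq"

definition less_omega1 :: "omega1 \<Rightarrow> omega1 \<Rightarrow> bool" where
  "a < b \<longleftrightarrow> a \<le> b \<and> \<not> b \<le> (a::omega1)"

instance
proof -
  let ?r = "cardSuc natLeq"
  have wo: "Well_order ?r"
    by (rule cardSuc_Well_order[OF natLeq_Card_order])
  note props = wo[unfolded well_order_on_def linear_order_on_def partial_order_on_def
      preorder_on_def]
  have tr: "trans ?r" and an: "antisym ?r" and re: "Refl ?r" and tot: "Total ?r"
    and wf: "wf (?r - Id)"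
    using props by blast+
  have refl: "x \<le> x" for x :: omega1
    using re Rep_omega1[of x] by (auto simp: less_eq_omega1_def refl_on_def)
  have antis: "x \<le> y \<Longrightarrow> y \<le> x \<Longrightarrow> x = y" for x y :: omega1
    using antisymD[OF an, of "Rep_omega1 x" "Rep_omega1 y"]
    by (simp add: less_eq_omega1_def Rep_omega1_inject)
  show "OFCLASS(omega1, wellorder_class)"
  proof intro_classes
    fix x y z :: omega1
    show "x < y \<longleftrightarrow> x \<le> y \<and> \<not> y \<le> x" by (rule less_omega1_def)
    show "x \<le> x" by (rule refl)
    show "x \<le> y \<Longrightarrow> y \<le> z \<Longrightarrow> x \<le> z"
      using tr by (auto simp: less_eq_omega1_def trans_def)
    show "x \<le> y \<Longrightarrow> y \<le> x \<Longrightarrow> x = y" by (rule antis)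
    show "x \<le> y \<or> y \<le> x"
      using tot Rep_omega1[of x] Rep_omega1[of y] refl[of x]
      by (cases "x = y") (auto simp: less_eq_omega1_def total_on_def Rep_omega1_inject)
  next
    fix P :: "omega1 \<Rightarrow> bool" and a
    assume step: "\<And>x. (\<And>y. y < x \<Longrightarrow> P y) \<Longrightarrow> P x"
    have "wf (inv_image (?r - Id) Rep_omega1)"
      using wf by (rule wf_inv_image)
    then show "P a"
    proof (induction a rule: wf_induct_rule)
      case (less x)
      show ?case
      proof (rule step)
        fix y assume "y < x"
        then have "(y, x) \<in> inv_image (?r - Id) Rep_omega1"
          by (auto simp: less_omega1_def less_eq_omega1_def)
        then show "P y" by (rule less)
      qed
    qed
  qed
qed

end

lemma uncountable_omega1: "uncountable (UNIV :: omega1 set)"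
proof
  include cardinal_syntax
  let ?r = "cardSuc natLeq"
  assume "countable (UNIV :: omega1 set)"
  then have "countable (range Rep_omega1)" by simp
  then have "countable (Field ?r)"
    using type_definition.Rep_range[OF type_definition_omega1] by simp
  then obtain f :: "_ \<Rightarrow> nat" where "inj_on f (Field ?r)"
    by (auto simp: countable_def)
  then have "|Field ?r| \<le>o |UNIV :: nat set|"
    using card_of_ordLeq by blast
  then have "?r \<le>o natLeq"
    using card_of_Field_ordIso[OF cardSuc_Card_order[OF natLeq_Card_order]] card_of_nat
      ordIso_ordLeq_trans ordIso_symmetric ordLeq_ordIso_trans by blast
  with cardSuc_greater[OF natLeq_Card_order] show False
    using not_ordLess_ordLeq by blast
qed

lemma countable_initial_segment: "countable {..<a::omega1}"
proof -
  include cardinal_syntax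
  let ?r = "cardSuc natLeq"
  have "|underS ?r (Rep_omega1 a)| <o ?r"
    by (rule card_of_underS[OF cardSuc_Card_order[OF natLeq_Card_order] Rep_omega1])
  then have "|underS ?r (Rep_omega1 a)| \<le>o natLeq"
    using cardSuc_ordLeq_ordLess[OF natLeq_Card_order card_of_Card_order] by blast
  then have "|underS ?r (Rep_omega1 a)| \<le>o |UNIV :: nat set|"
    using card_of_nat ordIso_symmetric ordLeq_ordIso_trans by blast
  then have "countable (underS ?r (Rep_omega1 a))"
    by (auto simp: countable_def card_of_ordLeq[symmetric])
  moreover have "Rep_omega1 ` {..<a} \<subseteq> underS ?r (Rep_omega1 a)"
    by (auto simp: underS_def less_omega1_def less_eq_omega1_def)
  ultimately have "countable (Rep_omega1 ` {..<a})"
    by (rule countable_subset[rotated])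
  then show ?thesis
    by (rule countable_image_inj_on) (simp add: inj_on_def Rep_omega1_inject)
qed

text \<open>\<open>\<omega>\<^sub>1\<close> has uncountable cofinality; hence all the minima \<open>LEAST\<close> below exist.\<close>

lemma countable_bounded:
  assumes "countable (A :: omega1 set)"
  obtains c where "\<And>a. a \<in> A \<Longrightarrow> a < c"
proof -
  have "countable (\<Union>a\<in>A. {..a})"
  proof (rule countable_UN[OF assms])
    fix a :: omega1
    have "{..a} = insert a {..<a}" by auto
    then show "countable {..a}" using countable_initial_segment[of a] by simp
  qed
  then obtain c where "c \<notin> (\<Union>a\<in>A. {..a})"
    using uncountable_omega1 by (metis UNIV_I countable_subset subsetI)
  then show ?thesis using that by (auto simp: not_le)
qed

subsection \<open>Ordinal arithmetic\<close>

text \<open>The operations are defined by transfinite recursion through a formula that covers zero,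
  successors and limits at once: \<open>a + b\<close> is the supremum of \<open>a\<close> and all \<open>(a + b') + 1\<close>,
  \<open>a * b\<close> that of all \<open>a * b' + a\<close>, and \<open>\<omega>\<^sup>b\<close> that of \<open>1\<close> and all \<open>\<omega>\<^sup>b\<^sup>' * \<omega>\<close>, for \<open>b' < b\<close>.
  The usual recursion equations are derived below.\<close>

instantiation omega1 :: "{zero, one, plus, times}"
begin

definition zero_omega1 :: omega1 where "0 = (LEAST a::omega1. True)"

definition one_omega1 :: omega1 where "1 = (LEAST a::omega1. 0 < a)"

function plus_omega1 :: "omega1 \<Rightarrow> omega1 \<Rightarrow> omega1" where
  [simp del]: "plus_omega1 a b = (LEAST c. a \<le> c \<and> (\<forall>b'\<in>{..<b}. plus_omega1 a b' < c))"
  by pat_completeness auto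
termination
  by (relation "inv_image {(x, y). x < y} snd") (rule wf_inv_image[OF wellorder_class.wf], simp)

function times_omega1 :: "omega1 \<Rightarrow> omega1 \<Rightarrow> omega1" where
  [simp del]: "times_omega1 a b = (LEAST c. \<forall>b'\<in>{..<b}. times_omega1 a b' + a \<le> c)"
  by pat_completeness auto
termination
  by (relation "inv_image {(x, y). x < y} snd") (rule wf_inv_image[OF wellorder_class.wf], simp)

instance ..

end

definition is_limit :: "omega1 \<Rightarrow> bool" where
  "is_limit a \<longleftrightarrow> a \<noteq> 0 \<and> (\<nexists>b. a = b + 1)"

definition omega :: omega1 where
  "omega = (LEAST a. is_limit a)"

function omega_pow :: "omega1 \<Rightarrow> omega1" where
  [simp del]: "omega_pow b = (LEAST c. 1 \<le> c \<and> (\<forall>b'\<in>{..<b}. omega_pow b' * omega \<le> c))"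
  by pat_completeness auto
termination by (relation "{(x, y). x < y}") (rule wellorder_class.wf, simp)

lemma omega1_zero_le [simp]: "0 \<le> (a::omega1)"
  by (simp add: zero_omega1_def Least_le)

lemma omega1_not_less_zero [simp]: "\<not> (a::omega1) < 0"
  by (simp add: not_less)

lemma omega1_zero_less_one [simp]: "0 < (1::omega1)"
proof -
  obtain c :: omega1 where "0 < c"
    by (rule countable_bounded[of "{0}"]) auto
  then show ?thesis unfolding one_omega1_def by (rule LeastI)
qed

lemma omega1_one_le_iff: "1 \<le> a \<longleftrightarrow> 0 < (a::omega1)"
  using omega1_zero_less_one less_le_trans Least_le[of "\<lambda>a::omega1. 0 < a" a]
  unfolding one_omega1_def[symmetric] by blast

lemma omega1_less_one_iff: "a < 1 \<longleftrightarrow> a = (0::omega1)"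
  using omega1_one_le_iff[of a] by (auto simp: not_le[symmetric] antisym)

lemma omega1_add_least:
  "a + b = (LEAST c. a \<le> c \<and> (\<forall>b'<b. a + b' < c))" for a b :: omega1
  by (subst plus_omega1.simps) (simp add: Ball_def)

lemma omega1_mult_least:
  "a * b = (LEAST c. \<forall>b'<b. a * b' + a \<le> c)" for a b :: omega1
  by (subst times_omega1.simps) (simp add: Ball_def)

lemma omega_pow_least:
  "omega_pow b = (LEAST c. 1 \<le> c \<and> (\<forall>b'<b. omega_pow b' * omega \<le> c))"
  by (subst omega_pow.simps) (simp add: Ball_def)

lemma countable_bounded_family:
  fixes b d :: omega1 and g :: "omega1 \<Rightarrow> omega1"
  obtains c where "\<And>b'. b' < b \<Longrightarrow> g b' < c" "d < c"
proof -
  have "countable (insert d (g ` {..<b}))"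
    using countable_initial_segment[of b] by simp
  then obtain c where "\<And>a. a \<in> insert d (g ` {..<b}) \<Longrightarrow> a < c"
    by (rule countable_bounded) blast
  then show ?thesis using that by auto
qed

lemma omega1_add_bounds:
  fixes a b :: omega1
  shows omega1_le_add: "a \<le> a + b"
    and omega1_add_strict_mono: "b' < b \<Longrightarrow> a + b' < a + b"
proof -
  obtain c where c: "\<And>b'. b' < b \<Longrightarrow> a + b' < c" "a < c"
    by (rule countable_bounded_family[of b "\<lambda>b'. a + b'" a]) blast
  have "a \<le> a + b \<and> (\<forall>b'<b. a + b' < a + b)"
    using LeastI[of "\<lambda>c. a \<le> c \<and> (\<forall>b'<b. a + b' < c)" c] c
    unfolding omega1_add_least[of a b, symmetric] by auto
  then show "a \<le> a + b" "b' < b \<Longrightarrow> a + b' < a + b" by auto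
qed

lemma omega1_add_le:
  "a \<le> c \<Longrightarrow> (\<And>b'. b' < b \<Longrightarrow> a + b' < c) \<Longrightarrow> a + b \<le> c" for a b c :: omega1
  by (subst omega1_add_least) (rule Least_le, blast)

lemma omega1_mult_upper: "b' < b \<Longrightarrow> a * b' + a \<le> a * b" for a b :: omega1
proof -
  assume b': "b' < b"
  obtain c where c: "\<And>b'. b' < b \<Longrightarrow> a * b' + a < c"
    by (rule countable_bounded_family[of b "\<lambda>b'. a * b' + a" a]) blast
  then have "\<forall>b'<b. a * b' + a \<le> a * b"
    using LeastI[of "\<lambda>c. \<forall>b'<b. a * b' + a \<le> c" c]
    unfolding omega1_mult_least[of a b, symmetric] by (auto intro: less_imp_le)
  then show ?thesis using b' by blast
qed

lemma omega1_mult_le: "(\<And>b'. b' < b \<Longrightarrow> a * b' + a \<le> c) \<Longrightarrow> a * b \<le> c" for a b c :: omega1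
  by (subst omega1_mult_least) (rule Least_le, blast)

lemma omega_pow_bounds:
  shows omega_pow_ge_1: "1 \<le> omega_pow b"
    and omega_pow_upper: "b' < b \<Longrightarrow> omega_pow b' * omega \<le> omega_pow b"
proof -
  obtain c where c: "\<And>b'. b' < b \<Longrightarrow> omega_pow b' * omega < c" "1 < c"
    by (rule countable_bounded_family[of b "\<lambda>b'. omega_pow b' * omega" 1]) blast
  have "1 \<le> omega_pow b \<and> (\<forall>b'<b. omega_pow b' * omega \<le> omega_pow b)"
    using LeastI[of "\<lambda>c. 1 \<le> c \<and> (\<forall>b'<b. omega_pow b' * omega \<le> c)" c] c
    unfolding omega_pow_least[of b, symmetric] by (auto intro: less_imp_le)
  then show "1 \<le> omega_pow b" "b' < b \<Longrightarrow> omega_pow b' * omega \<le> omega_pow b" by auto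
qed

lemma omega_pow_le:
  "1 \<le> c \<Longrightarrow> (\<And>b'. b' < b \<Longrightarrow> omega_pow b' * omega \<le> c) \<Longrightarrow> omega_pow b \<le> c"
  by (subst omega_pow_least) (rule Least_le, blast)

lemma omega1_add_zero [simp]: "a + 0 = (a::omega1)"
  by (rule antisym[OF omega1_add_le omega1_le_add]) auto

lemma omega1_less_add_one [simp]: "a < a + (1::omega1)"
  using omega1_add_strict_mono[of 0 1 a] by simp

lemma omega1_less_add_one_iff: "b < a + 1 \<longleftrightarrow> b \<le> (a::omega1)"
proof -
  have "a + 1 \<le> b" if "a < b"
    using that by (intro omega1_add_le) (auto simp: omega1_less_one_iff)
  then show ?thesis
    using omega1_less_add_one[of a] le_less_trans not_le by blast
qed

lemma omega1_add_one_le_iff: "a + 1 \<le> b \<longleftrightarrow> a < (b::omega1)"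
  using omega1_less_add_one_iff[of b a] by (simp add: not_less[symmetric])

lemma omega1_add_one_inject [simp]: "a + 1 = b + 1 \<longleftrightarrow> a = (b::omega1)"
  by (metis antisym omega1_less_add_one omega1_less_add_one_iff)

lemma omega1_zero_add_one [simp]: "0 + 1 = (1::omega1)"
  by (rule antisym) (auto simp: omega1_add_one_le_iff omega1_one_le_iff
      intro: le_less_trans[OF _ omega1_less_add_one])

lemma omega1_add_one_neq_zero [simp]: "a + 1 \<noteq> (0::omega1)"
  using omega1_less_add_one[of a] by (metis omega1_not_less_zero)

lemma is_limit_less: "is_limit a \<Longrightarrow> b < a \<Longrightarrow> b + 1 < a"
  unfolding is_limit_def by (metis le_less omega1_add_one_le_iff)

lemma omega1_cases:
  fixes a :: omega1
  obtains "a = 0" | b where "a = b + 1" | "is_limit a"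
  unfolding is_limit_def by blast

lemma not_is_limit [simp]: "\<not> is_limit 0" "\<not> is_limit (a + 1)"
  by (auto simp: is_limit_def)

lemma omega1_add_succ: "a + (b + 1) = (a + b) + (1::omega1)"
proof (rule antisym)
  show "a + (b + 1) \<le> (a + b) + 1"
  proof (rule omega1_add_le)
    show "a \<le> (a + b) + 1"
      by (meson less_imp_le omega1_le_add order_trans)
    fix b' assume "b' < b + 1"
    then have "a + b' \<le> a + b"
      using omega1_add_strict_mono[of b' b a] by (auto simp: omega1_less_add_one_iff le_less)
    then show "a + b' < a + b + 1" by (simp add: omega1_less_add_one_iff)
  qed
qed (simp add: omega1_add_one_le_iff omega1_add_strict_mono)

lemma omega1_add_limit:
  assumes "is_limit b"
  shows "a + b = (LEAST c. \<forall>b'<b. a + b' \<le> c)"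
proof (rule antisym)
  let ?P = "\<lambda>c. \<forall>b'<b. a + b' \<le> c"
  have P: "?P (a + b)" using omega1_add_strict_mono by (auto intro: less_imp_le)
  then have Q: "?P (LEAST c. ?P c)" by (rule LeastI)
  show "(LEAST c. ?P c) \<le> a + b" using P by (rule Least_le)
  show "a + b \<le> (LEAST c. ?P c)"
  proof (rule omega1_add_le)
    have "0 < b" using assms by (metis is_limit_def omega1_zero_le order_le_less)
    then show "a \<le> (LEAST c. ?P c)" using Q by force
    fix b' assume "b' < b"
    then have "a + (b' + 1) \<le> (LEAST c. ?P c)"
      using Q is_limit_less[OF assms] by blast
    then show "a + b' < (LEAST c. ?P c)"
      by (simp add: omega1_add_succ omega1_add_one_le_iff)
  qed
qed

lemma omega1_add_right_mono: "a \<le> a' \<Longrightarrow> a + b \<le> a' + b" for a a' b :: omega1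
proof (induction b rule: less_induct)
  case (less b)
  show ?case
  proof (rule omega1_add_le)
    show "a \<le> a' + b" using less.prems omega1_le_add order_trans by blast
    fix b' assume "b' < b"
    then show "a + b' < a' + b"
      using less omega1_add_strict_mono le_less_trans by blast
  qed
qed

lemma omega1_mult_mono: "b \<le> c \<Longrightarrow> a * b \<le> a * c" for a b c :: omega1
  by (rule omega1_mult_le) (blast intro: omega1_mult_upper less_le_trans)

lemma omega1_mult_zero [simp]: "a * 0 = (0::omega1)"
  by (rule antisym) (auto intro: omega1_mult_le)

lemma omega1_mult_succ: "a * (b + 1) = a * b + (a::omega1)"
proof (rule antisym)
  show "a * (b + 1) \<le> a * b + a"
    by (rule omega1_mult_le)
      (simp add: omega1_less_add_one_iff omega1_add_right_mono omega1_mult_mono)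
qed (simp add: omega1_mult_upper)

lemma omega1_mult_limit:
  assumes "is_limit b"
  shows "a * b = (LEAST c. \<forall>b'<b. a * b' \<le> c)"
proof (rule antisym)
  let ?P = "\<lambda>c. \<forall>b'<b. a * b' \<le> c"
  have P: "?P (a * b)" using omega1_mult_mono by (auto intro: less_imp_le)
  then have Q: "?P (LEAST c. ?P c)" by (rule LeastI)
  show "(LEAST c. ?P c) \<le> a * b" using P by (rule Least_le)
  show "a * b \<le> (LEAST c. ?P c)"
    using Q is_limit_less[OF assms]
    by (intro omega1_mult_le) (simp add: omega1_mult_succ[symmetric])
qed

lemma omega_pow_mono: "b \<le> c \<Longrightarrow> omega_pow b \<le> omega_pow c"
  by (rule omega_pow_le) (blast intro: omega_pow_ge_1 omega_pow_upper less_le_trans)+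

lemma omega1_mult_right_mono: "a \<le> a' \<Longrightarrow> a * b \<le> a' * b" for a a' b :: omega1
proof (induction b rule: less_induct)
  case (less b)
  show ?case
  proof (rule omega1_mult_le)
    fix b' assume b': "b' < b"
    have "a * b' + a \<le> a' * b' + a"
      using less b' by (intro omega1_add_right_mono) blast
    also have "\<dots> \<le> a' * b' + a'"
      using less.prems omega1_add_strict_mono[of a a' "a' * b'"] by (auto simp: le_less)
    also have "\<dots> \<le> a' * b" using b' by (rule omega1_mult_upper)
    finally show "a * b' + a \<le> a' * b" .
  qed
qed

lemma omega_pow_zero [simp]: "omega_pow 0 = 1"
  by (rule antisym) (auto intro: omega_pow_le omega_pow_ge_1)

lemma omega_limit: "is_limit omega"
proof -
  define s :: "nat \<Rightarrow> omega1" where "s n = ((\<lambda>a. a + 1) ^^ n) 0" for n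
  have "countable (range s)" by simp
  then obtain d where d: "\<forall>n. s n < d"
    using countable_bounded[of "range s"] by (metis rangeI)
  define c where "c = (LEAST c. \<forall>n. s n < c)"
  have c: "\<forall>n. s n < c"
    unfolding c_def using d by (rule LeastI)
  have "is_limit c"
    unfolding is_limit_def
  proof safe
    assume "c = 0" then show False using c omega1_not_less_zero by metis
  next
    fix b assume b: "c = b + 1"
    have "s n < b" for n
    proof -
      have "s n + 1 = s (Suc n)" by (simp add: s_def)
      also have "\<dots> \<le> b" using c b by (simp add: omega1_less_add_one_iff)
      finally show ?thesis by (simp add: omega1_add_one_le_iff)
    qed
    then have "c \<le> b" unfolding c_def by (intro Least_le) blast
    then show False using b omega1_less_add_one[of b] by (simp add: not_le[symmetric])
  qed
  then show ?thesis unfolding omega_def by (rule LeastI)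
qed

lemma omega_pow_succ: "omega_pow (b + 1) = omega_pow b * omega"
proof (rule antisym)
  show "omega_pow (b + 1) \<le> omega_pow b * omega"
  proof (rule omega_pow_le)
    have "1 < omega"
      using omega_limit is_limit_less[OF omega_limit, of 0]
      by (metis is_limit_def omega1_zero_add_one omega1_zero_le order_le_less)
    then have "omega_pow b * 1 + omega_pow b \<le> omega_pow b * omega"
      by (rule omega1_mult_upper)
    moreover have "0 < omega_pow b * 1 + omega_pow b"
      using omega1_add_strict_mono[of 0 "omega_pow b" "omega_pow b * 1"] omega_pow_ge_1[of b]
      by (auto simp: omega1_one_le_iff intro: le_less_trans[OF omega1_zero_le])
    ultimately show "1 \<le> omega_pow b * omega"
      by (simp add: omega1_one_le_iff less_le_trans)
    show "omega_pow b' * omega \<le> omega_pow b * omega" if "b' < b + 1" for b'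
      using that by (simp add: omega1_less_add_one_iff omega1_mult_right_mono omega_pow_mono)
  qed
qed (simp add: omega_pow_upper)

lemma omega_pow_limit:
  assumes "is_limit b"
  shows "omega_pow b = (LEAST c. \<forall>b'<b. omega_pow b' \<le> c)"
proof (rule antisym)
  let ?P = "\<lambda>c. \<forall>b'<b. omega_pow b' \<le> c"
  have P: "?P (omega_pow b)" using omega_pow_mono by (auto intro: less_imp_le)
  then have Q: "?P (LEAST c. ?P c)" by (rule LeastI)
  show "(LEAST c. ?P c) \<le> omega_pow b" using P by (rule Least_le)
  have "0 < b" using assms by (metis is_limit_def omega1_zero_le order_le_less)
  then have "1 \<le> (LEAST c. ?P c)" using Q omega_pow_zero by force
  then show "omega_pow b \<le> (LEAST c. ?P c)"
    using Q is_limit_less[OF assms]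
    by (intro omega_pow_le) (simp_all add: omega_pow_succ[symmetric])
qed

section \<open>Schreier families\<close>

text \<open>The set \<open>\<nat>\<close> of the mathematical text is \<open>{1..}\<close>: all families consist of finite
  sets of positive integers, and all sequences are indexed from \<open>1\<close>; their values at \<open>0\<close> are
  irrelevant. \<open>nonempty F\<close> is written with a hat on \<open>F\<close> in the text, \<open>conv F G\<close> is \<open>F[G]\<close>.\<close>

definition nonempty :: "nat set set \<Rightarrow> nat set set" where
  "nonempty F = F - {{}}"

definition conv :: "nat set set \<Rightarrow> nat set set \<Rightarrow> nat set set" where
  "conv F G = insert {} {\<Union>i\<in>{1..s}. E i | s (E :: nat \<Rightarrow> nat set).
     (\<forall>i\<in>{1..s}. E i \<in> nonempty G) \<and>
     (\<forall>i\<in>{1..<s}. Max (E i) < Min (E (i + 1))) \<and>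
     {Min (E i) | i. i \<in> {1..s}} \<in> F}"

definition schreier0 :: "nat set set" where
  "schreier0 = {E. finite E \<and> E \<subseteq> {1..} \<and> card E \<le> 1}"

definition schreier1 :: "nat set set" where
  "schreier1 = insert {} {E. finite E \<and> E \<noteq> {} \<and> E \<subseteq> {1..} \<and> card E \<le> Min E}"

text \<open>The argument \<open>x\<close> supplies the sequence \<open>(x \<xi> n)\<^sub>n\<close> fixed for each limit ordinal \<open>\<xi>\<close>. The
  condition \<open>x \<xi> n + 1 < \<xi>\<close> makes the recursion well-founded for arbitrary \<open>x\<close>; it holds
  automatically when \<open>x \<xi> n < \<xi>\<close>, see \<open>schreier_limit\<close>.\<close>

function schreier :: "(omega1 \<Rightarrow> nat \<Rightarrow> omega1) \<Rightarrow> omega1 \<Rightarrow> nat set set" where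
  [simp del]: "schreier x \<xi> =
    (if \<xi> = 0 then schreier0
     else if \<exists>\<eta>. \<xi> = \<eta> + 1 then conv schreier1 (schreier x (THE \<eta>. \<xi> = \<eta> + 1))
     else {E. \<exists>n\<in>{n. 1 \<le> n \<and> x \<xi> n + 1 < \<xi>}. (\<forall>k\<in>E. n \<le> k) \<and> E \<in> schreier x (x \<xi> n + 1)})"
  by pat_completeness auto
termination
  by (relation "inv_image {(x, y). x < y} snd") (rule wf_inv_image[OF wellorder_class.wf], auto)

lemma schreier_zero: "schreier x 0 = schreier0"
  by (simp add: schreier.simps)

lemma schreier_succ: "schreier x (\<xi> + 1) = conv schreier1 (schreier x \<xi>)"
  by (subst schreier.simps) simp

lemma schreier_limit:
  assumes "is_limit \<xi>" "\<And>n. 1 \<le> n \<Longrightarrow> x \<xi> n < \<xi>"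
  shows "schreier x \<xi> = {E. \<exists>n\<ge>1. (\<forall>k\<in>E. n \<le> k) \<and> E \<in> schreier x (x \<xi> n + 1)}"
proof -
  have "x \<xi> n + 1 < \<xi>" if "1 \<le> n" for n
    using is_limit_less[OF assms(1) assms(2)[OF that]] .
  then show ?thesis
    using assms(1) by (subst schreier.simps) (auto simp: is_limit_def)
qed

lemma schreier_one: "schreier x 1 = schreier1"
proof -
  have "schreier x 1 = conv schreier1 schreier0"
    using schreier_succ[of x 0] by (simp add: schreier_zero)
  also have "\<dots> = schreier1"
  proof (intro set_eqI iffI)
    fix A assume "A \<in> conv schreier1 schreier0"
    then consider "A = {}" | s and E :: "nat \<Rightarrow> nat set"
      where "A = (\<Union>i\<in>{1..s}. E i)" "\<forall>i\<in>{1..s}. E i \<in> nonempty schreier0"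
        "{Min (E i) | i. i \<in> {1..s}} \<in> schreier1"
      unfolding conv_def by blast
    then show "A \<in> schreier1"
    proof cases
      case 2
      have "E i = {Min (E i)}" if "i \<in> {1..s}" for i
      proof -
        have "finite (E i)" "E i \<noteq> {}" "card (E i) \<le> 1"
          using 2(2) that by (auto simp: nonempty_def schreier0_def)
        then have "card (E i) = 1" by (metis One_nat_def Suc_leI card_gt_0_iff le_antisym)
        then show ?thesis by (metis Min_singleton card_1_singletonE)
      qed
      then have "A = {Min (E i) | i. i \<in> {1..s}}" unfolding 2(1) by fastforce
      then show ?thesis using 2(3) by simp
    qed (simp add: schreier1_def)
  next
    fix A assume A: "A \<in> schreier1"
    show "A \<in> conv schreier1 schreier0"
    proof (cases "A = {}")
      case False
      then have fin: "finite A" "A \<subseteq> {1..}" using A by (auto simp: schreier1_def)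
      let ?E = "\<lambda>i. {sorted_list_of_set A ! (i - 1)}"
      let ?s = "card A"
      have img: "(\<lambda>i. sorted_list_of_set A ! (i - 1)) ` {1..?s} = A"
      proof -
        have "(\<lambda>i. sorted_list_of_set A ! (i - 1)) ` {1..?s}
            = (\<lambda>i. sorted_list_of_set A ! i) ` {..<?s}"
        proof -
          have "{..<?s} = (\<lambda>i. i - 1) ` {1..?s}"
            by (force simp: image_iff intro: bexI[where x = "Suc _"])
          then show ?thesis by (simp add: image_image)
        qed
        also have "\<dots> = set (sorted_list_of_set A)"
          by (auto simp: set_conv_nth)
        finally show ?thesis using fin by simp
      qed
      have "(\<Union>i\<in>{1..?s}. ?E i) = A" using img by blast
      moreover have "{Min (?E i) | i. i \<in> {1..?s}} \<in> schreier1"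
        using img A unfolding Setcompr_eq_image by simp
      moreover have "\<forall>i\<in>{1..?s}. ?E i \<in> nonempty schreier0"
        using img fin(2) by (force simp: nonempty_def schreier0_def)
      moreover have "\<forall>i\<in>{1..<?s}. Max (?E i) < Min (?E (i + 1))"
        using strict_sorted_list_of_set[of A]
        by (auto simp: sorted_wrt_iff_nth_less)
      ultimately show ?thesis unfolding conv_def by blast
    qed (simp add: conv_def)
  qed
  finally show ?thesis .
qed

definition admissible :: "(omega1 \<Rightarrow> nat \<Rightarrow> omega1) \<Rightarrow> bool" where
  "admissible x \<longleftrightarrow> (\<forall>\<xi>. is_limit \<xi> \<longrightarrow>
     (\<forall>n\<ge>1. x \<xi> n < x \<xi> (n + 1)) \<and>
     (\<forall>n\<ge>1. x \<xi> n < \<xi>) \<and> (\<forall>\<eta><\<xi>. \<exists>n\<ge>1. \<eta> < x \<xi> n) \<and>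
     (\<forall>n\<ge>1. schreier x (x \<xi> n + 1) \<subseteq> schreier x (x \<xi> (n + 1))))"

text \<open>\<open>select M E\<close> is \<open>M(E) = {m\<^sub>n | n \<in> E}\<close> for \<open>M = {m\<^sub>1 < m\<^sub>2 < \<dots>}\<close>; the library's
  \<^const>\<open>enumerate\<close> counts from \<open>0\<close>.\<close>

definition select :: "nat set \<Rightarrow> nat set \<Rightarrow> nat set" where
  "select M E = {enumerate M (n - 1) | n. n \<in> E}"

end

theory Submission
  imports Defs
begin

text \<open>
  Write \<open>S\<close> for \<open>\<S>\<^sub>\<omega>\<^sup>\<xi>\<close>. The family \<open>S\<close> is a diagonal union: a set \<open>E\<close> belongs to \<open>S\<close> iff for some
  \<open>n \<ge> 1\<close> with \<open>n \<le> E\<close> it belongs to a simpler family \<open>G n\<close>. For \<open>\<xi> = 0\<close> the family \<open>G n\<close> consists of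
  the sets with at most \<open>n\<close> elements; for \<open>\<xi> > 0\<close> the ordinal \<open>\<omega>\<^sup>\<xi>\<close> is a limit and \<open>G n\<close> is the
  Schreier family of the \<open>n\<close>-th approximating ordinal plus one, an ordinal below \<open>\<omega>\<^sup>\<xi>\<close>.

  Suppose that for every \<open>n\<close> each infinite set \<open>L\<close> has an infinite subset on which \<open>f\<close> equals \<open>1\<close> at
  all non-empty members of \<open>G n\<close>. Diagonalising over \<open>n\<close> gives \<open>M = {m\<^sub>1 < m\<^sub>2 < \<dots>}\<close> whose tail from \<open>m\<^sub>n\<close>
  on is good for \<open>G n\<close>. If \<open>E \<in> G n\<close> and \<open>n \<le> E\<close>, then \<open>M(E)\<close> lies in that tail, and it lies in
  \<open>G n\<close> because these families are stable under moving elements to the right. So \<open>f\<close> equals \<open>1\<close> at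
  \<open>M(E)\<close>: this is the first alternative.

  Otherwise there are one single \<open>n\<close> and one infinite \<open>L\<close> all of whose infinite subsets contain a
  non-empty \<open>E \<in> G n\<close> with \<open>f E = 0\<close> (\<open>diagonal_dichotomy\<close>). Hence there are \<open>E\<^sub>1 < E\<^sub>2 < \<dots>\<close> in \<open>G n\<close>
  with \<open>f (E\<^sub>i) = 0\<close> whose minima grow as fast as desired. What makes the unions work is that the
  bound \<open>\<alpha> < \<omega>\<^sup>\<xi>\<close> on the complexity of the blocks does not depend on \<open>i\<close>: sparse unions of
  \<open>\<S>\<^sub>\<alpha>\<close>-blocks along a set of \<open>\<S>\<^sub>\<beta>\<close> belong to the family of index \<open>\<alpha> + \<beta>\<close> (\<open>schreier_blocks\<close>),
  and \<open>\<alpha> + \<omega>\<^sup>\<xi> = \<omega>\<^sup>\<xi>\<close> (\<open>add_omega_pow_absorb\<close>), so for \<open>\<beta> = \<omega>\<^sup>\<xi>\<close> the unions stay in \<open>S\<close>. For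
  \<open>\<xi> = 0\<close> a count of elements takes the place of this argument (\<open>schreier1_blocks\<close>).
\<close>

section \<open>Ordinal arithmetic\<close>

lemma omega1_add_left_mono: "b \<le> c \<Longrightarrow> a + b \<le> a + c" for a b c :: omega1
  using omega1_add_strict_mono[of b c a] by (auto simp: le_less)

lemma omega1_zero_add: "0 + b = b" for b :: omega1
proof (induction b rule: less_induct)
  case (less b)
  show ?case
  proof (rule antisym)
    show "0 + b \<le> b" by (rule omega1_add_le) (simp_all add: less)
    show "b \<le> 0 + b"
    proof (rule ccontr)
      assume "\<not> b \<le> 0 + b"
      then have lt: "0 + b < b" by simp
      then have "0 + (0 + b) = 0 + b" by (rule less)
      then show False using omega1_add_strict_mono[OF lt, of 0] by simp
    qed
  qed
qed

lemma omega1_less_addE: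
  fixes b c d :: omega1
  assumes "d < b + c"
  obtains "d < b" | c' where "c' < c" "d \<le> b + c'"
  using assms omega1_add_le[of b d c] by (meson linorder_not_less)

lemma omega1_add_assoc: "(a + b) + c = a + (b + c)" for a b c :: omega1
proof (induction c rule: less_induct)
  case (less c)
  show ?case
  proof (rule antisym)
    show "(a + b) + c \<le> a + (b + c)"
      by (rule omega1_add_le)
        (simp_all add: less omega1_add_left_mono omega1_le_add omega1_add_strict_mono)
    show "a + (b + c) \<le> (a + b) + c"
    proof (rule omega1_add_le)
      show "a \<le> (a + b) + c" using omega1_le_add order_trans by blast
      fix d assume "d < b + c"
      then show "a + d < (a + b) + c"
      proof (cases rule: omega1_less_addE)
        case 1
        then show ?thesis
          using omega1_add_strict_mono omega1_le_add less_le_trans by blast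
      next
        case (2 c')
        then have "a + d \<le> (a + b) + c'" using less omega1_add_left_mono by simp
        also have "\<dots> < (a + b) + c" using 2 by (simp add: omega1_add_strict_mono)
        finally show ?thesis .
      qed
    qed
  qed
qed

text \<open>Below \<open>a * \<omega>\<close> one is below some \<open>a * k\<close> with \<open>k\<close> finite, so adding finitely many copies of
  \<open>a\<close> does not leave \<open>a * \<omega>\<close>.\<close>

lemma add_less_mult_omega:
  fixes a :: omega1
  assumes a: "0 < a" and \<gamma>: "\<gamma> < a * omega" and \<delta>: "\<delta> < a * omega"
  shows "\<gamma> + \<delta> < a * omega"
proof -
  have below: "\<exists>k<omega. \<gamma> < a * (k + 1)" if "\<gamma> < a * omega" for \<gamma>
    unfolding omega1_mult_succ
    using omega1_mult_le[of omega a \<gamma>] that by (meson linorder_not_less)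
  have step: "\<gamma> + a < a * omega" if lt: "\<gamma> < a * omega" for \<gamma>
  proof -
    obtain k where k: "k < omega" "\<gamma> < a * (k + 1)" using below[OF lt] by blast
    have "\<gamma> + a \<le> a * (k + 1 + 1)"
      using k(2) by (simp add: omega1_mult_succ omega1_add_right_mono less_imp_le)
    also have "\<dots> < a * (k + 1 + 1) + a"
      using omega1_add_strict_mono[OF a] by simp
    also have "\<dots> \<le> a * omega"
      using k(1) is_limit_less[OF omega_limit] by (intro omega1_mult_upper) blast
    finally show ?thesis .
  qed
  have fin: "\<gamma> + a * c < a * omega" if "c < omega" for c
    using that
  proof (induction c rule: less_induct)
    case (less c)
    have "\<not> is_limit c"
      using less.prems Least_le[of is_limit c] by (auto simp: omega_def)
    then consider "c = 0" | c' where "c = c' + 1" by (auto simp: is_limit_def)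
    then show ?case
    proof cases
      case 1
      then show ?thesis using \<gamma> by simp
    next
      case (2 c')
      then have "c' < c" by simp
      with less have "(\<gamma> + a * c') + a < a * omega"
        by (intro step) (blast intro: less_trans)
      then show ?thesis by (simp add: 2 omega1_mult_succ omega1_add_assoc)
    qed
  qed
  obtain k where k: "k < omega" "\<delta> < a * (k + 1)" using below[OF \<delta>] by blast
  then have "\<gamma> + \<delta> < \<gamma> + a * (k + 1)" by (simp add: omega1_add_strict_mono)
  also have "\<dots> < a * omega" using k(1) is_limit_less[OF omega_limit] by (intro fin) blast
  finally show ?thesis .
qed

text \<open>A power of \<open>\<omega>\<close> above \<open>1\<close> is the supremum of the ordinals \<open>\<omega>\<^sup>b * \<omega>\<close> with \<open>b < \<xi>\<close>, each of which
  is closed under addition.\<close>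

lemma add_less_omega_pow:
  assumes \<gamma>: "\<gamma> < omega_pow \<xi>" and \<delta>: "\<delta> < omega_pow \<xi>"
  shows "\<gamma> + \<delta> < omega_pow \<xi>"
proof (cases "\<gamma> = 0 \<or> \<delta> = 0")
  case True
  then show ?thesis using assms by (auto simp: omega1_zero_add)
next
  case False
  have below: "\<exists>b<\<xi>. \<beta> < omega_pow b * omega" if "\<beta> < omega_pow \<xi>" "\<beta> \<noteq> 0" for \<beta>
    using that omega_pow_le[of \<beta> \<xi>]
    by (metis not_less omega1_less_one_iff)
  obtain b where b: "b < \<xi>" "\<gamma> < omega_pow b * omega" using below[OF \<gamma>] False by blast
  obtain b' where b': "b' < \<xi>" "\<delta> < omega_pow b' * omega" using below[OF \<delta>] False by blast
  let ?b = "max b b'"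
  have "omega_pow b * omega \<le> omega_pow ?b * omega" "omega_pow b' * omega \<le> omega_pow ?b * omega"
    by (simp_all add: omega1_mult_right_mono omega_pow_mono)
  then have "\<gamma> + \<delta> < omega_pow ?b * omega"
    using b b' omega_pow_ge_1[of ?b]
    by (intro add_less_mult_omega) (auto simp: omega1_one_le_iff)
  also have "\<dots> \<le> omega_pow \<xi>" using b b' by (intro omega_pow_upper) simp
  finally show ?thesis .
qed

lemma add_omega_pow_absorb:
  assumes "\<alpha> < omega_pow \<xi>"
  shows "\<alpha> + omega_pow \<xi> = omega_pow \<xi>"
proof (rule antisym)
  show "\<alpha> + omega_pow \<xi> \<le> omega_pow \<xi>"
    using assms by (intro omega1_add_le add_less_omega_pow less_imp_le)
  show "omega_pow \<xi> \<le> \<alpha> + omega_pow \<xi>"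
    using omega1_add_right_mono[of 0 \<alpha> "omega_pow \<xi>"] by (simp add: omega1_zero_add)
qed

lemma is_limit_omega_pow:
  assumes "\<xi> \<noteq> 0"
  shows "is_limit (omega_pow \<xi>)"
  unfolding is_limit_def
proof safe
  show False if "omega_pow \<xi> = 0"
    using omega_pow_ge_1[of \<xi>] that by (simp add: omega1_one_le_iff)
  fix \<gamma> assume eq: "omega_pow \<xi> = \<gamma> + 1"
  have "0 < omega" using omega_limit omega1_zero_le[of omega] by (auto simp: is_limit_def le_less)
  then have "1 < omega" using is_limit_less[OF omega_limit] by force
  then have "1 * 1 + 1 \<le> 1 * omega" by (rule omega1_mult_upper)
  moreover have "1 * 1 = (1::omega1)"
    using omega1_mult_succ[of 1 0] by (simp add: omega1_zero_add)
  ultimately have "1 < 1 * omega" by (simp add: omega1_add_one_le_iff)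
  also have "\<dots> \<le> omega_pow \<xi>"
    using omega_pow_upper[of 0 \<xi>] assms omega1_zero_le[of \<xi>] by (auto simp: le_less)
  finally have "\<gamma> + 1 < omega_pow \<xi>" using eq by (intro add_less_omega_pow) simp_all
  then show False using eq by simp
qed

section \<open>Unions of blocks in Schreier families\<close>

text \<open>Moving the elements to the right keeps the cardinality and can only raise the minimum.\<close>

lemma schreier1_spread:
  assumes "A \<in> schreier1" and mono: "\<And>i j. i \<in> A \<Longrightarrow> j \<in> A \<Longrightarrow> i < j \<Longrightarrow> \<phi> i < \<phi> j"
    and ge: "\<And>i. i \<in> A \<Longrightarrow> i \<le> \<phi> i"
  shows "\<phi> ` A \<in> schreier1"
proof (cases "A = {}")
  case False
  then have A: "finite A" "A \<subseteq> {1..}" "card A \<le> Min A" using assms(1) by (auto simp: schreier1_def)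
  have "card (\<phi> ` A) \<le> Min A" using card_image_le[OF A(1), of \<phi>] A(3) by simp
  also have "\<dots> \<le> Min (\<phi> ` A)"
    using A(1) False by (auto intro: order_trans[OF Min_le ge])
  finally show ?thesis using A(1,2) False ge by (force simp: schreier1_def)
qed (simp add: schreier1_def)

text \<open>The function \<open>g\<close> measures how sparse the successive blocks are. The lemmas below ask for it only
  on the index set \<open>A\<close>, so that the property passes to subsets of \<open>A\<close>.\<close>

definition blocks :: "nat set set \<Rightarrow> (nat \<Rightarrow> nat) \<Rightarrow> nat set \<Rightarrow> (nat \<Rightarrow> nat set) \<Rightarrow> bool" where
  "blocks G g A E \<longleftrightarrow> (\<forall>i\<in>A. E i \<in> nonempty G \<and> g i \<le> Min (E i)) \<and>
     (\<forall>i\<in>A. \<forall>j\<in>A. i < j \<longrightarrow> Max (E i) < Min (E j))"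

lemma blocks_mono:
  assumes "blocks G g A E" "B \<subseteq> A" "\<And>i. i \<in> B \<Longrightarrow> h i \<le> g i"
  shows "blocks G h B E"
  using assms unfolding blocks_def by (meson order_trans subsetD)

text \<open>This is the successor step of two inductions, on spreading and on unions of blocks. Group the
  blocks along the decomposition of \<open>A\<close> into members \<open>H j\<close> of \<open>B\<close>. The minimum of the \<open>j\<close>-th group is
  that of the block with index \<open>Min (H j)\<close>, so the minima of the groups arise from those of the \<open>H j\<close>
  by a move to the right.\<close>

lemma conv_blocks:
  assumes A: "A \<in> conv schreier1 B" and fB: "\<And>F. F \<in> B \<Longrightarrow> finite F"
    and fG: "\<And>F. F \<in> G \<Longrightarrow> finite F"
    and E: "blocks G (\<lambda>i. i) A E"
    and C: "\<And>F. F \<in> B \<Longrightarrow> F \<subseteq> A \<Longrightarrow> (\<Union>i\<in>F. E i) \<in> C"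
  shows "(\<Union>i\<in>A. E i) \<in> conv schreier1 C"
proof (cases "A = {}")
  case False
  then obtain s and H :: "nat \<Rightarrow> nat set" where H: "A = (\<Union>j\<in>{1..s}. H j)"
      "\<forall>j\<in>{1..s}. H j \<in> nonempty B" "\<forall>j\<in>{1..<s}. Max (H j) < Min (H (j + 1))"
      "{Min (H j) | j. j \<in> {1..s}} \<in> schreier1"
    using A unfolding conv_def by blast
  define U where "U j = (\<Union>i\<in>H j. E i)" for j
  have E': "finite (E i)" "E i \<noteq> {}" "i \<le> Min (E i)" if "i \<in> A" for i
  proof -
    have "E i \<in> G \<and> E i \<noteq> {} \<and> i \<le> Min (E i)"
      using E that by (simp add: blocks_def nonempty_def)
    then show "finite (E i)" "E i \<noteq> {}" "i \<le> Min (E i)" using fG by blast+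
  qed
  have H': "finite (H j)" "H j \<noteq> {}" "H j \<subseteq> A" "H j \<in> B" if "j \<in> {1..s}" for j
    using H(1,2) fB that by (auto simp: nonempty_def)
  have less: "a < b" if "i \<in> A" "i' \<in> A" "i < i'" "a \<in> E i" "b \<in> E i'" for i i' a b
  proof -
    have "a \<le> Max (E i)" "Min (E i') \<le> b" using that E' by simp_all
    then show ?thesis using E that unfolding blocks_def by fastforce
  qed
  have finU: "finite (U j)" "U j \<noteq> {}" if "j \<in> {1..s}" for j
    using H'[OF that] E' by (force simp: U_def)+
  have MinU: "Min (U j) = Min (E (Min (H j)))" if j: "j \<in> {1..s}" for j
  proof (rule Min_eqI)
    have m: "Min (H j) \<in> H j" "Min (H j) \<in> A" using H'[OF j] Min_in[of "H j"] by blast+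
    show "Min (E (Min (H j))) \<in> U j" 
      using Min_in[OF E'(1,2)[OF m(2)]] m(1) unfolding U_def by blast
    fix y assume "y \<in> U j"
    then obtain i where i: "i \<in> H j" "y \<in> E i" by (auto simp: U_def)
    show "Min (E (Min (H j))) \<le> y"
    proof (cases "i = Min (H j)")
      case True
      then show ?thesis using i E' m by simp
    next
      case False
      then have "Min (H j) < i" using i H'[OF j] by (simp add: le_neq_implies_less)
      then have "Min (E (Min (H j))) < y"
        using less[OF m(2) _ _ Min_in[OF E'(1,2)[OF m(2)]] i(2)] i(1) H'(3)[OF j] by blast
      then show ?thesis by simp
    qed
  qed (use finU j in simp)
  have "(\<Union>i\<in>A. E i) = (\<Union>j\<in>{1..s}. U j)" using H(1) by (auto simp: U_def)
  moreover have "\<forall>j\<in>{1..s}. U j \<in> nonempty C"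
    using finU H' C by (auto simp: nonempty_def U_def)
  moreover have "\<forall>j\<in>{1..<s}. Max (U j) < Min (U (j + 1))"
  proof
    fix j assume "j \<in> {1..<s}"
    then have j: "j \<in> {1..s}" "j + 1 \<in> {1..s}" "Max (H j) < Min (H (j + 1))" using H(3) by auto
    have "a < b" if "a \<in> U j" "b \<in> U (j + 1)" for a b
    proof -
      obtain i i' where i: "i \<in> H j" "a \<in> E i" "i' \<in> H (j + 1)" "b \<in> E i'"
        using \<open>a \<in> U j\<close> \<open>b \<in> U (j + 1)\<close> by (auto simp: U_def)
      have "i \<le> Max (H j)" "Min (H (j + 1)) \<le> i'" using i j H' by simp_all
      then have "i < i'" using j(3) by linarith
      then show ?thesis using less[OF _ _ _ i(2,4)] i(1,3) H'(3) j(1,2) by blast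
    qed
    from this[OF Max_in[OF finU[OF j(1)]] Min_in[OF finU[OF j(2)]]]
    show "Max (U j) < Min (U (j + 1))" .
  qed
  moreover have "{Min (U j) | j. j \<in> {1..s}} \<in> schreier1"
  proof -
    have "{Min (U j) | j. j \<in> {1..s}} = (\<lambda>i. Min (E i)) ` {Min (H j) | j. j \<in> {1..s}}"
      unfolding Setcompr_eq_image image_image by (rule image_cong[OF refl MinU])
    also have "\<dots> \<in> schreier1"
    proof (rule schreier1_spread[OF H(4)])
      have sub: "{Min (H j) | j. j \<in> {1..s}} \<subseteq> A" using H'(1-3) Min_in by blast
      show "i \<le> Min (E i)" if "i \<in> {Min (H j) | j. j \<in> {1..s}}" for i
        using E'(3) sub that by blast
      show "Min (E i) < Min (E j)" if "i \<in> {Min (H j) | j. j \<in> {1..s}}"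
        "j \<in> {Min (H j) | j. j \<in> {1..s}}" "i < j" for i j
      proof -
        have A: "i \<in> A" "j \<in> A" using that(1,2) sub by blast+
        show ?thesis
          by (rule less[OF A that(3) Min_in[OF E'(1,2)[OF A(1)]] Min_in[OF E'(1,2)[OF A(2)]]])
      qed
    qed
    finally show ?thesis .
  qed
  ultimately show ?thesis unfolding conv_def by blast
qed (simp add: conv_def)

lemma conv_superset:
  assumes "\<And>E. E \<in> G \<Longrightarrow> finite E \<and> E \<subseteq> {1..}"
  shows "G \<subseteq> conv schreier1 G"
proof
  fix A assume A: "A \<in> G"
  show "A \<in> conv schreier1 G"
  proof (cases "A = {}")
    case False
    then have "1 \<le> Min A" using assms[OF A] by auto
    then have "{Min A | i. i \<in> {1..1::nat}} \<in> schreier1"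
      by (simp add: schreier1_def)
    moreover have "A = (\<Union>i\<in>{1..1::nat}. A)" by simp
    ultimately show ?thesis
      unfolding conv_def using A False
      by (intro insertI2 CollectI exI[of _ "1::nat"] exI[of _ "\<lambda>_. A"]) (simp add: nonempty_def)
  qed (simp add: conv_def)
qed

lemma schreier_admissible_limit:
  assumes "admissible x" "is_limit \<beta>"
  shows "schreier x \<beta> = {E. \<exists>n\<ge>1. (\<forall>k\<in>E. n \<le> k) \<and> E \<in> schreier x (x \<beta> n + 1)}"
  using assms by (intro schreier_limit) (auto simp: admissible_def)

lemma admissible_less:
  assumes "admissible x" "is_limit \<beta>" "1 \<le> n"
  shows "x \<beta> n + 1 < \<beta>"
  using assms by (intro is_limit_less) (auto simp: admissible_def)

lemma schreier_finite_pos: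
  assumes "admissible x" "E \<in> schreier x \<beta>"
  shows "finite E \<and> E \<subseteq> {1..}"
  using assms(2)
proof (induction \<beta> arbitrary: E rule: less_induct)
  case (less \<beta>)
  show ?case
  proof (cases \<beta> rule: omega1_cases)
    case 1
    then show ?thesis using less.prems by (simp add: schreier_zero schreier0_def)
  next
    case (2 b)
    then have part: "finite F \<and> F \<subseteq> {1..}" if "F \<in> nonempty (schreier x b)" for F
      using less.IH[of b] that by (simp add: nonempty_def)
    have "E \<in> conv schreier1 (schreier x b)"
      using less.prems 2 by (simp add: schreier_succ)
    then consider "E = {}" | s and H :: "nat \<Rightarrow> nat set"
      where "E = (\<Union>i\<in>{1..s}. H i)" "\<forall>i\<in>{1..s}. H i \<in> nonempty (schreier x b)"
      unfolding conv_def by blast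
    then show ?thesis
    proof cases
      case (2 s H)
      then show ?thesis using part by auto
    qed simp
  next
    case 3
    then show ?thesis
      using less schreier_admissible_limit[OF assms(1) 3] admissible_less[OF assms(1) 3] by blast
  qed
qed

text \<open>Spreading is the case of singleton blocks: \<open>\<phi> ` A\<close> is the union of the \<open>{\<phi> i}\<close>.\<close>

lemma schreier_spread:
  assumes adm: "admissible x" and "A \<in> schreier x \<beta>"
    and "\<And>i j. i \<in> A \<Longrightarrow> j \<in> A \<Longrightarrow> i < j \<Longrightarrow> \<phi> i < \<phi> j" and "\<And>i. i \<in> A \<Longrightarrow> i \<le> \<phi> i"
  shows "\<phi> ` A \<in> schreier x \<beta>"
  using assms(2-)
proof (induction \<beta> arbitrary: A rule: less_induct)
  case (less \<beta>)
  show ?case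
  proof (cases \<beta> rule: omega1_cases)
    case 1
    then show ?thesis
      using less.prems(1,3) card_image_le[of A \<phi>]
      by (force simp: schreier_zero schreier0_def)
  next
    case (2 b)
    have "(\<Union>i\<in>A. {\<phi> i}) \<in> conv schreier1 (schreier x b)"
    proof (rule conv_blocks)
      show "A \<in> conv schreier1 (schreier x b)" using less.prems(1) 2 by (simp add: schreier_succ)
      show "blocks {F. finite F} (\<lambda>i. i) A (\<lambda>i. {\<phi> i})"
        using less.prems by (simp add: blocks_def nonempty_def)
      fix F assume F: "F \<in> schreier x b"
      then show "finite F" using schreier_finite_pos[OF adm] by blast
      assume "F \<subseteq> A"
      then have "\<phi> ` F \<in> schreier x b" 
        using 2 F less.prems by (intro less.IH) (simp_all add: subset_iff)
      then show "(\<Union>i\<in>F. {\<phi> i}) \<in> schreier x b" by (simp add: UNION_singleton_eq_range)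
    qed simp
    then show ?thesis by (simp add: 2 schreier_succ UNION_singleton_eq_range)
  next
    case 3
    then obtain n where n: "n \<ge> 1" "\<forall>k\<in>A. n \<le> k" "A \<in> schreier x (x \<beta> n + 1)"
      using less.prems(1) schreier_admissible_limit[OF adm 3] by auto
    have "\<phi> ` A \<in> schreier x (x \<beta> n + 1)"
      using less.prems n admissible_less[OF adm 3] by (intro less.IH) auto
    moreover have "\<forall>k\<in>\<phi> ` A. n \<le> k" using n(2) less.prems(3) order_trans by blast
    ultimately show ?thesis
      unfolding schreier_admissible_limit[OF adm 3] using n(1) by blast
  qed
qed

text \<open>The Schreier families need not increase with their index, but they do when finitely many integers
  are ignored. At a limit \<open>\<delta>\<close>, the approximating sequence passes \<open>\<gamma>\<close> at some place \<open>n\<close>, and sets that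
  start at \<open>n\<close> or later may use the family at that place.\<close>

lemma schreier_eventually_subset:
  assumes adm: "admissible x" and "\<gamma> < \<delta>"
  shows "\<exists>m. \<forall>E\<in>schreier x \<gamma>. (\<forall>k\<in>E. m \<le> k) \<longrightarrow> E \<in> schreier x \<delta>"
  using assms(2)
proof (induction \<delta> rule: less_induct)
  case (less \<delta>)
  show ?case
  proof (cases \<delta> rule: omega1_cases)
    case 1
    then show ?thesis using less.prems by simp
  next
    case (2 d)
    have "schreier x d \<subseteq> schreier x \<delta>"
      unfolding 2 schreier_succ using schreier_finite_pos[OF adm] by (intro conv_superset)
    then show ?thesis
      using less 2 by (metis le_less omega1_less_add_one omega1_less_add_one_iff subsetD)
  next
    case 3
    then obtain n where n: "n \<ge> 1" "\<gamma> < x \<delta> n" 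
      using adm less.prems unfolding admissible_def by blast
    then have "\<gamma> < x \<delta> n + 1" by (simp add: omega1_less_add_one_iff)
    then obtain m where
      m: "\<forall>E\<in>schreier x \<gamma>. (\<forall>k\<in>E. m \<le> k) \<longrightarrow> E \<in> schreier x (x \<delta> n + 1)"
      using less.IH admissible_less[OF adm 3 n(1)] by blast
    show ?thesis
      using m n(1) unfolding schreier_admissible_limit[OF adm 3]
      by (intro exI[of _ "max m n"]) auto
  qed
qed

text \<open>The sequences chosen at the limits \<open>\<beta>\<close> and \<open>\<alpha> + \<beta>\<close> are unrelated. What bridges them is the
  eventual inclusion of the family at \<open>\<alpha> + (\<beta>\<^sub>n + 1)\<close> in that at \<open>\<alpha> + \<beta>\<close>, paid for by sparsity of the
  blocks.\<close>

lemma schreier_blocks: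
  assumes adm: "admissible x"
  shows "\<exists>g. \<forall>A\<in>schreier x \<beta>. \<forall>E. blocks (schreier x \<alpha>) g A E \<longrightarrow>
    (\<Union>i\<in>A. E i) \<in> schreier x (\<alpha> + \<beta>)"
proof (induction \<beta> rule: less_induct)
  case (less \<beta>)
  have empty: "{} \<in> schreier x \<gamma>" for \<gamma>
  proof (cases "\<gamma> = 0")
    case True
    then show ?thesis by (simp add: schreier_zero schreier0_def)
  next
    case False
    then have "0 < \<gamma>" by (metis omega1_zero_le order_le_less)
    moreover have "{} \<in> schreier x 0" by (simp add: schreier_zero schreier0_def)
    ultimately show ?thesis using schreier_eventually_subset[OF adm] by blast
  qed
  show ?case
  proof (cases \<beta> rule: omega1_cases)
    case 1
    have "(\<Union>i\<in>A. E i) \<in> schreier x \<alpha>"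
      if A: "A \<in> schreier0" and E: "blocks (schreier x \<alpha>) (\<lambda>_. 0) A E" for A E
    proof (cases "A = {}")
      case False
      then obtain i where "A = {i}" using A
        by (auto simp: schreier0_def le_Suc_eq card_1_singleton_iff)
      then show ?thesis using E by (simp add: blocks_def nonempty_def)
    qed (simp add: empty)
    then show ?thesis unfolding 1 schreier_zero omega1_add_zero by blast
  next
    case (2 b)
    then obtain g where g: "\<And>A E. A \<in> schreier x b \<Longrightarrow> blocks (schreier x \<alpha>) g A E \<Longrightarrow>
        (\<Union>i\<in>A. E i) \<in> schreier x (\<alpha> + b)"
      using less[of b] by auto
    have "(\<Union>i\<in>A. E i) \<in> conv schreier1 (schreier x (\<alpha> + b))"
      if A: "A \<in> conv schreier1 (schreier x b)"
        and E: "blocks (schreier x \<alpha>) (\<lambda>i. max i (g i)) A E" for A E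
    proof (rule conv_blocks[OF A])
      show "blocks (schreier x \<alpha>) (\<lambda>i. i) A E" by (rule blocks_mono[OF E]) auto
      show "(\<Union>i\<in>F. E i) \<in> schreier x (\<alpha> + b)" if "F \<in> schreier x b" "F \<subseteq> A" for F
        using that by (intro g blocks_mono[OF E]) auto
    qed (use schreier_finite_pos[OF adm] in blast)+
    then show ?thesis unfolding 2 omega1_add_succ schreier_succ by blast
  next
    case 3
    have "\<forall>n\<ge>1. \<exists>g. \<forall>A\<in>schreier x (x \<beta> n + 1). \<forall>E. blocks (schreier x \<alpha>) g A E \<longrightarrow>
        (\<Union>i\<in>A. E i) \<in> schreier x (\<alpha> + (x \<beta> n + 1))"
      using less admissible_less[OF adm 3] by blast
    then obtain g where g: "\<And>n A E. n \<ge> 1 \<Longrightarrow> A \<in> schreier x (x \<beta> n + 1) \<Longrightarrow>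
        blocks (schreier x \<alpha>) (g n) A E \<Longrightarrow> (\<Union>i\<in>A. E i) \<in> schreier x (\<alpha> + (x \<beta> n + 1))"
      by metis
    have "\<forall>n\<ge>1. \<exists>m. \<forall>E\<in>schreier x (\<alpha> + (x \<beta> n + 1)).
        (\<forall>k\<in>E. m \<le> k) \<longrightarrow> E \<in> schreier x (\<alpha> + \<beta>)"
      using schreier_eventually_subset[OF adm] omega1_add_strict_mono admissible_less[OF adm 3]
      by blast
    then obtain m where m: "\<And>n E. n \<ge> 1 \<Longrightarrow> E \<in> schreier x (\<alpha> + (x \<beta> n + 1)) \<Longrightarrow>
        \<forall>k\<in>E. m n \<le> k \<Longrightarrow> E \<in> schreier x (\<alpha> + \<beta>)"
      by metis
    \<comment> \<open>A set \<open>A\<close> taken from place \<open>n\<close> has all indices \<open>i \<ge> n\<close>, so \<open>h i\<close> has to dominate only the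
      finitely many thresholds of the places up to \<open>i\<close>.\<close>
    define h where "h i = (\<Sum>n\<le>i. g n i + m n)" for i
    have h: "g n i \<le> h i" "m n \<le> h i" if "n \<le> i" for n i
      using member_le_sum[of n "{..i}" "\<lambda>n. g n i + m n"] that by (simp_all add: h_def)
    have "(\<Union>i\<in>A. E i) \<in> schreier x (\<alpha> + \<beta>)"
      if A: "A \<in> schreier x \<beta>" and E: "blocks (schreier x \<alpha>) h A E" for A E
    proof -
      obtain n where n: "n \<ge> 1" "\<forall>k\<in>A. n \<le> k" "A \<in> schreier x (x \<beta> n + 1)"
        using A unfolding schreier_admissible_limit[OF adm 3] by auto
      show ?thesis
      proof (rule m[OF n(1)])
        show "(\<Union>i\<in>A. E i) \<in> schreier x (\<alpha> + (x \<beta> n + 1))"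
          using n h by (intro g[of n] blocks_mono[OF E]) auto
        show "\<forall>k\<in>\<Union>i\<in>A. E i. m n \<le> k"
        proof
          fix k assume "k \<in> (\<Union>i\<in>A. E i)"
          then obtain i where i: "i \<in> A" "k \<in> E i" by blast
          have "m n \<le> h i" using n(2) h(2) i(1) by blast
          also have "h i \<le> Min (E i)"
            using E i(1) by (simp add: blocks_def)
          also have "Min (E i) \<le> k"
            using E i schreier_finite_pos[OF adm, of "E i" \<alpha>]
            by (simp add: blocks_def nonempty_def)
          finally show "m n \<le> k" .
        qed
      qed
    qed
    then show ?thesis by blast
  qed
qed

section \<open>The dichotomy\<close>

definition spreading :: "nat set set \<Rightarrow> bool" where
  "spreading G \<longleftrightarrow> (\<forall>M E. infinite M \<longrightarrow> M \<subseteq> {1..} \<longrightarrow> E \<in> G \<longrightarrow> select M E \<in> G)"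

lemma select_eq_image: "select M E = (\<lambda>n. enumerate M (n - 1)) ` E"
  by (auto simp: select_def)

lemma enumerate_pos_ge:
  assumes "infinite M" "M \<subseteq> {1..}"
  shows "Suc n \<le> enumerate M n"
proof (induction n)
  case 0
  then show ?case using enumerate_in_set[OF assms(1), of 0] assms(2) by auto
next
  case (Suc n)
  then show ?case using enumerate_step[OF assms(1), of n] by simp
qed

lemma spreading_schreier:
  assumes "admissible x"
  shows "spreading (schreier x \<beta>)"
  unfolding spreading_def select_eq_image
proof (intro allI impI)
  fix M E :: "nat set" assume M: "infinite M" "M \<subseteq> {1..}" and E: "E \<in> schreier x \<beta>"
  have pos: "1 \<le> i" if "i \<in> E" for i using schreier_finite_pos[OF assms E] that by auto
  show "(\<lambda>n. enumerate M (n - 1)) ` E \<in> schreier x \<beta>"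
  proof (rule schreier_spread[OF assms E])
    show "i \<le> enumerate M (i - 1)" if "i \<in> E" for i
      using enumerate_pos_ge[OF M, of "i - 1"] pos[OF that] by simp
    show "enumerate M (i - 1) < enumerate M (j - 1)" if "i \<in> E" "j \<in> E" "i < j" for i j
      using pos that M by (intro enumerate_mono) (auto simp: diff_less_mono)
  qed
qed

text \<open>If no pair \<open>(n, L)\<close> is as in the second case, then good infinite
  subsets can be chosen one inside the other for \<open>n = 1, 2, \<dots>\<close>, and a diagonal sequence through them
  serves all \<open>n\<close> at once.\<close>

lemma diagonal_dichotomy:
  fixes G :: "nat \<Rightarrow> nat set set"
  assumes spr: "\<And>n. n \<ge> 1 \<Longrightarrow> spreading (G n)"
  obtains M where "infinite M" "M \<subseteq> {1..}"
      "\<And>n E. n \<ge> 1 \<Longrightarrow> E \<in> nonempty (G n) \<Longrightarrow> \<forall>k\<in>E. n \<le> k \<Longrightarrow> P (select M E)"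
  | n L where "n \<ge> 1" "infinite L" "L \<subseteq> {1..}"
      "\<And>M. M \<subseteq> L \<Longrightarrow> infinite M \<Longrightarrow> \<exists>E\<in>nonempty (G n). E \<subseteq> M \<and> \<not> P E"
proof (cases "\<exists>n\<ge>1. \<exists>L. infinite L \<and> L \<subseteq> {1..} \<and>
    (\<forall>M\<subseteq>L. infinite M \<longrightarrow> (\<exists>E\<in>nonempty (G n). E \<subseteq> M \<and> \<not> P E))")
  case True
  then show ?thesis using that(2) by blast
next
  case False
  \<comment> \<open>Stage \<open>n\<close> treats the family \<open>G (n + 1)\<close>: stages are counted from \<open>0\<close>, the families from \<open>1\<close>.\<close>
  let ?good = "\<lambda>n N. infinite N \<and> N \<subseteq> {1..} \<and> (\<forall>E\<in>nonempty (G (Suc n)). E \<subseteq> N \<longrightarrow> P E)"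
  have ex: "\<exists>N\<subseteq>L. ?good n N" if "infinite L" "L \<subseteq> {1..}" for n L
    using False that by (metis le_add1 plus_1_eq_Suc subset_trans)
  have "\<exists>p. \<forall>n. (?good n (fst (p n)) \<and> snd (p n) \<in> fst (p n)) \<and>
      (fst (p (Suc n)) \<subseteq> fst (p n) \<and> snd (p n) < snd (p (Suc n)))"
  proof (rule dependent_nat_choice)
    have "infinite {1::nat..}" by (rule infinite_Ici)
    then obtain N where N: "?good 0 N" using ex[of "{1..}" 0] by auto
    then obtain k where "k \<in> N" using infinite_imp_nonempty by blast
    with N show "\<exists>p. ?good 0 (fst p) \<and> snd p \<in> fst p" by (intro exI[of _ "(N, k)"]) simp
  next
    fix p :: "nat set \<times> nat" and n
    assume p: "?good n (fst p) \<and> snd p \<in> fst p"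
    then obtain N where N: "N \<subseteq> fst p" "?good (Suc n) N" using ex[of "fst p" "Suc n"] by auto
    then obtain k where "k \<in> N" "snd p < k" by (meson infinite_nat_iff_unbounded)
    with N show "\<exists>q. (?good (Suc n) (fst q) \<and> snd q \<in> fst q) \<and> fst q \<subseteq> fst p \<and> snd p < snd q"
      by (intro exI[of _ "(N, k)"]) simp
  qed
  then obtain p where "\<forall>n. (?good n (fst (p n)) \<and> snd (p n) \<in> fst (p n)) \<and>
      (fst (p (Suc n)) \<subseteq> fst (p n) \<and> snd (p n) < snd (p (Suc n)))" ..
  from spec[OF this] have p: "?good n (fst (p n))" "snd (p n) \<in> fst (p n)"
      "fst (p (Suc n)) \<subseteq> fst (p n)" "snd (p n) < snd (p (Suc n))" for n
    by (rule conjunct1[OF conjunct1], rule conjunct2[OF conjunct1],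
        rule conjunct1[OF conjunct2], rule conjunct2[OF conjunct2])
  define r where "r n = snd (p n)" for n
  have r: "strict_mono r" using p(4) by (simp add: r_def strict_mono_Suc_iff)
  have in_tail: "r j \<in> fst (p i)" if "i \<le> j" for i j
    using p(2)[of j] lift_Suc_antimono_le[of "\<lambda>n. fst (p n)", OF p(3) that] by (auto simp: r_def)
  have inf: "infinite (range r)" using r by (simp add: strict_mono_imp_inj_on finite_image_iff)
  have pos: "range r \<subseteq> {1..}" using p(1,2) by (force simp: r_def)
  \<comment> \<open>In fact \<open>l = j\<close>; the inequality is easier to obtain and puts the \<open>j\<close>-th element into all sets
    chosen up to stage \<open>j\<close>.\<close>
  have enum: "\<exists>l\<ge>j. enumerate (range r) j = r l" for j
  proof (induction j)
    case 0
    then show ?case using enumerate_in_set[OF inf, of 0] by auto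
  next
    case (Suc j)
    then obtain l where l: "l \<ge> j" "enumerate (range r) j = r l" by blast
    obtain l' where l': "enumerate (range r) (Suc j) = r l'"
      using enumerate_in_set[OF inf, of "Suc j"] by auto
    then have "l < l'"
      using enumerate_step[OF inf, of j] l(2) strict_mono_less[OF r] by simp
    then show ?case using l(1) l' by (intro exI[of _ l']) simp
  qed
  show ?thesis
  proof (rule that(1)[OF inf pos])
    fix n E assume n: "n \<ge> 1" and E: "E \<in> nonempty (G n)" "\<forall>k\<in>E. n \<le> k"
    obtain n' where n': "n = Suc n'" using n by (cases n) auto
    have "select (range r) E \<in> nonempty (G (Suc n'))"
      using spr[OF n] inf pos E(1) n' by (auto simp: spreading_def nonempty_def select_eq_image)
    moreover have "select (range r) E \<subseteq> fst (p n')"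
    proof
      fix y assume "y \<in> select (range r) E"
      then obtain k where k: "k \<in> E" "y = enumerate (range r) (k - 1)"
        by (auto simp: select_eq_image)
      then obtain l where "l \<ge> k - 1" "y = r l" using enum by blast
      moreover have "n' \<le> k - 1" using E(2) k(1) n' by auto
      ultimately show "y \<in> fst (p n')" using in_tail by simp
    qed
    ultimately show "P (select (range r) E)" using p(1) by blast
  qed
qed

text \<open>The combinatorial core, for any diagonal union of spreading families in which sparse unions of
  \<open>G n\<close>-blocks, for a fixed \<open>n\<close>, stay in \<open>S\<close>. In the second case of the dichotomy the blocks are found
  one after the other in tails of \<open>L\<close>.\<close>

lemma ones_or_zero_blocks:
  fixes G :: "nat \<Rightarrow> nat set set" and f :: "nat set \<Rightarrow> nat"
  assumes spr: "\<And>n. n \<ge> 1 \<Longrightarrow> spreading (G n)"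
    and fin: "\<And>n E. n \<ge> 1 \<Longrightarrow> E \<in> G n \<Longrightarrow> finite E"
    and S: "S = {E. \<exists>n\<ge>1. (\<forall>k\<in>E. n \<le> k) \<and> E \<in> G n}"
    and thr: "\<And>n. n \<ge> 1 \<Longrightarrow> \<exists>g. \<forall>A\<in>S. \<forall>E. blocks (G n) g A E \<longrightarrow> (\<Union>i\<in>A. E i) \<in> S"
    and f: "f \<in> nonempty S \<rightarrow> {0, 1}"
  shows "(\<exists>M \<subseteq> {1..}. infinite M \<and> (\<forall>E \<in> nonempty S. f (select M E) = 1)) \<or>
         (\<exists>E :: nat \<Rightarrow> nat set. (\<forall>i\<ge>1. E i \<in> nonempty S) \<and>
            (\<forall>i\<ge>1. Max (E i) < Min (E (i + 1))) \<and> (\<forall>i\<ge>1. f (E i) = 0) \<and>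
            (\<forall>F \<in> S. (\<Union>i\<in>F. E i) \<in> S))"
proof (rule diagonal_dichotomy[of G "\<lambda>E. f E = 1", OF spr])
  fix M assume "infinite M" "M \<subseteq> {1..}"
      "\<And>n E. n \<ge> 1 \<Longrightarrow> E \<in> nonempty (G n) \<Longrightarrow> \<forall>k\<in>E. n \<le> k \<Longrightarrow> f (select M E) = 1"
  moreover from this have "\<forall>E \<in> nonempty S. f (select M E) = 1"
    by (auto simp: S nonempty_def)
  ultimately show ?thesis by blast
next
  fix n L assume n: "n \<ge> 1" and L: "infinite L" "L \<subseteq> {1..}"
    and zero: "\<And>M. M \<subseteq> L \<Longrightarrow> infinite M \<Longrightarrow> \<exists>E\<in>nonempty (G n). E \<subseteq> M \<and> f E \<noteq> 1"
  obtain g where g: "\<And>A E. A \<in> S \<Longrightarrow> blocks (G n) g A E \<Longrightarrow> (\<Union>i\<in>A. E i) \<in> S"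
    using thr[OF n] by blast
  \<comment> \<open>The condition \<open>n \<le> Min E\<close> makes each block itself a member of \<open>S\<close>.\<close>
  let ?Q = "\<lambda>i E. E \<in> nonempty (G n) \<and> f E \<noteq> 1 \<and> n \<le> Min E \<and> g i \<le> Min E"
  have ex: "\<exists>E. ?Q i E \<and> b < Min E" for i b
  proof -
    let ?c = "max (max n (g i)) (Suc b)"
    have "infinite (L \<inter> {?c..})" using L(1) infinite_nat_iff_unbounded_le[of L]
      unfolding infinite_nat_iff_unbounded_le[of "L \<inter> _"]
      by (metis Int_iff atLeast_iff max.boundedE max.cobounded1 max.cobounded2 order_trans)
    then obtain E where E: "E \<in> nonempty (G n)" "E \<subseteq> L \<inter> {?c..}" "f E \<noteq> 1"
      using zero[of "L \<inter> {?c..}"] by blast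
    then have "Min E \<in> E" using fin[OF n] by (auto simp: nonempty_def)
    then have "?c \<le> Min E" using E(2) by blast
    then show ?thesis using E by (intro exI[of _ E]) auto
  qed
  obtain E where E: "\<And>i. ?Q i (E i)" "\<And>i. Max (E i) < Min (E (Suc i))"
    using dependent_nat_choice[of ?Q "\<lambda>i A B. Max A < Min B"] ex by blast
  have E': "E i \<in> nonempty S" for i
  proof -
    have "finite (E i)" using E(1)[of i] fin[OF n] by (auto simp: nonempty_def)
    then have "\<forall>k\<in>E i. n \<le> k" using E(1)[of i] by (meson Min_le order_trans)
    then show ?thesis using E(1)[of i] n by (auto simp: S nonempty_def)
  qed
  have less: "Max (E i) < Min (E j)" if "i < j" for i j
    using that
  proof (induction j)
    case (Suc j)
    have "Min (E j) \<le> Max (E j)"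
      using E(1)[of j] fin[OF n, of "E j"] by (auto simp: nonempty_def)
    then show ?case using Suc E(2)[of j] by (cases "i = j") auto
  qed simp
  have "f (E i) = 0" for i using f E' E(1)[of i] by fastforce
  moreover have "(\<Union>i\<in>F. E i) \<in> S" if "F \<in> S" for F
    using E(1) less by (intro g[OF that]) (simp add: blocks_def)
  ultimately show ?thesis using E(2) E' by (intro disjI2 exI[of _ E]) simp
qed

text \<open>With at most \<open>Min A\<close> blocks of at most \<open>n\<close> elements each, the union has at most \<open>n * Min A\<close>
  elements, and sparsity puts its minimum above that number.\<close>

lemma schreier1_blocks:
  assumes A: "A \<in> schreier1"
    and E: "blocks {E. finite E \<and> E \<subseteq> {1..} \<and> card E \<le> n} (\<lambda>i. n * i) A E"
  shows "(\<Union>i\<in>A. E i) \<in> schreier1"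
proof (cases "A = {}")
  case False
  then have A': "finite A" "card A \<le> Min A" using A by (auto simp: schreier1_def)
  have E': "finite (E i)" "E i \<noteq> {}" "E i \<subseteq> {1..}" "card (E i) \<le> n" "n * i \<le> Min (E i)"
    if "i \<in> A" for i
    using E that by (simp_all add: blocks_def nonempty_def del: Min_ge_iff)
  let ?U = "\<Union>i\<in>A. E i"
  have U: "finite ?U" "?U \<noteq> {}" using A'(1) E'(1,2) False by simp_all
  have pos: "?U \<subseteq> {1..}" using E'(3) by (rule UN_least)
  have "card ?U \<le> (\<Sum>i\<in>A. card (E i))" using A'(1) by (rule card_UN_le)
  also have "\<dots> \<le> n * card A"
    using sum_bounded_above[of A "\<lambda>i. card (E i)" n] E' by (simp add: mult.commute)
  also have "\<dots> \<le> n * Min A" using A' by simp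
  also have "\<dots> \<le> Min ?U"
  proof -
    have "n * Min A \<le> y" if y: "y \<in> ?U" for y
    proof -
      obtain i where i: "i \<in> A" "y \<in> E i" using y by blast
      have "n * Min A \<le> n * i" using A' i by simp
      also have "\<dots> \<le> Min (E i)" using E' i by simp
      also have "\<dots> \<le> y" using E' i by simp
      finally show ?thesis .
    qed
    then show ?thesis using U by simp
  qed
  finally show ?thesis using U pos unfolding schreier1_def by blast
qed (simp add: schreier1_def)

theorem lemma3p5:
  fixes x :: "omega1 \<Rightarrow> nat \<Rightarrow> omega1" and \<xi> :: omega1 and f :: "nat set \<Rightarrow> nat"
  assumes "admissible x"
    and "f \<in> nonempty (schreier x (omega_pow \<xi>)) \<rightarrow> {0, 1}"
  shows "(\<exists>M \<subseteq> {1..}. infinite M \<and>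
            (\<forall>E \<in> nonempty (schreier x (omega_pow \<xi>)). f (select M E) = 1)) \<or>
         (\<exists>E :: nat \<Rightarrow> nat set.
            (\<forall>i\<ge>1. E i \<in> nonempty (schreier x (omega_pow \<xi>))) \<and>
            (\<forall>i\<ge>1. Max (E i) < Min (E (i + 1))) \<and>
            (\<forall>i\<ge>1. f (E i) = 0) \<and>
            (\<forall>F \<in> schreier x (omega_pow \<xi>). (\<Union>i\<in>F. E i) \<in> schreier x (omega_pow \<xi>)))"
proof (cases "\<xi> = 0")
  case True
  let ?G = "\<lambda>n. {E. finite E \<and> E \<subseteq> {1..} \<and> card E \<le> (n::nat)}"
  have S: "schreier x (omega_pow \<xi>) = schreier1" by (simp add: True schreier_one)
  show ?thesis
  proof (rule ones_or_zero_blocks[where G = ?G, OF _ _ _ _ assms(2)])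
    show "spreading (?G n)" for n
      unfolding spreading_def select_eq_image
    proof (intro allI impI)
      fix M E :: "nat set" assume "infinite M" "M \<subseteq> {1..}" "E \<in> ?G n"
      then show "(\<lambda>n. enumerate M (n - 1)) ` E \<in> ?G n"
        using enumerate_in_set[of M] card_image_le[of E "\<lambda>n. enumerate M (n - 1)"] by force
    qed
    show "schreier x (omega_pow \<xi>) = {E. \<exists>n\<ge>1. (\<forall>k\<in>E. n \<le> k) \<and> E \<in> ?G n}"
    proof (intro set_eqI iffI)
      fix E assume E: "E \<in> schreier x (omega_pow \<xi>)"
      show "E \<in> {E. \<exists>n\<ge>1. (\<forall>k\<in>E. n \<le> k) \<and> E \<in> ?G n}"
      proof (cases "E = {}")
        case False
        then have E': "finite E" "E \<subseteq> {1..}" "card E \<le> Min E" using E by (auto simp: S schreier1_def)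
        moreover have "1 \<le> Min E" using Min_in[OF E'(1) False] E'(2) by auto
        moreover have "\<forall>k\<in>E. Min E \<le> k" using E'(1) by simp
        ultimately show ?thesis by blast
      qed auto
    next
      fix E assume "E \<in> {E. \<exists>n\<ge>1. (\<forall>k\<in>E. n \<le> k) \<and> E \<in> ?G n}"
      then obtain n where n: "\<forall>k\<in>E. n \<le> k" "finite E" "E \<subseteq> {1..}" "card E \<le> n" by blast
      show "E \<in> schreier x (omega_pow \<xi>)"
      proof (cases "E = {}")
        case False
        then have "n \<le> Min E" using n(1,2) by simp
        then show ?thesis using n False order_trans by (simp only: S schreier1_def) blast
      qed (simp add: S schreier1_def)
    qed
    show "\<exists>g. \<forall>A\<in>schreier x (omega_pow \<xi>). \<forall>E. blocks (?G n) g A E \<longrightarrow>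
        (\<Union>i\<in>A. E i) \<in> schreier x (omega_pow \<xi>)" for n
      unfolding S using schreier1_blocks by blast
  qed auto
next
  case False
  note lim = is_limit_omega_pow[OF False]
  show ?thesis
  proof (rule ones_or_zero_blocks[where G = "\<lambda>n. schreier x (x (omega_pow \<xi>) n + 1)",
        OF _ _ schreier_admissible_limit[OF assms(1) lim] _ assms(2)])
    fix n :: nat assume "n \<ge> 1"
    then have "x (omega_pow \<xi>) n + 1 + omega_pow \<xi> = omega_pow \<xi>"
      using admissible_less[OF assms(1) lim] by (intro add_omega_pow_absorb)
    then show "\<exists>g. \<forall>A\<in>schreier x (omega_pow \<xi>). \<forall>E.
        blocks (schreier x (x (omega_pow \<xi>) n + 1)) g A E \<longrightarrow>
        (\<Union>i\<in>A. E i) \<in> schreier x (omega_pow \<xi>)"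
      using schreier_blocks[OF assms(1), of "omega_pow \<xi>" "x (omega_pow \<xi>) n + 1"] by simp
  qed (use spreading_schreier schreier_finite_pos assms(1) in blast)+
qed

end
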